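(* Let $X$ be a regular continuum and let $G$ be a group acting on $X$ by homeomorphisms. Then the dynamical system $(G,X)$ is null; hence it is also tame.
   Context: A continuum is a compact connected Hausdorff space. A topological space $X$ is regular (also called rim-finite) if every point has a local base of open sets each of which has finite boundary. Null: for a sequence $S=\{s_1,s_2,\dots\}\subset G$ and a finite open cover $\mathbf{A}$ of $X$ put $$h_{top}(X,\mathbf{A};S)=\lim_{n\to\infty}\frac1n\log N\Big(\bigvee_{i=1}^n s_i(\mathbf{A})\Big),$$ where $s_i(\mathbf{A})=\{s_iA: A\in\mathbf{A}\}$, $\bigvee$ denotes the common refinement of covers (all intersections of one member from each cover), and $N(\cdot)$ is the minimal cardinality of a subcover. The system $(G,X)$ is null if $h_{top}(X,\mathbf{A};S)=0$ (in particular the limit exists) for all finite open covers $\mathbf{A}$ of $X$ and all sequences $S$ in $G$. Tame: a sequence $(f_n)_{n\in\mathbb{N}}$ of real-valued functions on a set $X$ is independent if there are real numbers $a<b$ such that $\bigcap_{n\in P}f_n^{-1}(-\infty,a)\cap\bigcap_{n\in M}f_n^{-1}(b,\infty)\neq\emptyset$ for all finite disjoint $P,M\subset\mathbb{N}$. The system $(G,X)$ is tame if for every continuous $f:X\to\mathbb{R}$ the family $fG=\{fg: g\in G\}$, where $(fg)(x)=f(gx)$, contains no independent sequence. *)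

theory Defs
  imports "HOL-Analysis.Analysis" "HOL-Algebra.Group_Action"
begin

definition continuum_space :: "'a topology \<Rightarrow> bool" where
  "continuum_space X \<longleftrightarrow> compact_space X \<and> connected_space X \<and> Hausdorff_space X"

text \<open>``Regular'' in the sense of continuum theory; unrelated to the separation axiom
  \<^const>\<open>regular_space\<close>.\<close>

definition rim_finite_space :: "'a topology \<Rightarrow> bool" where
  "rim_finite_space X \<longleftrightarrow>
     (\<forall>x\<in>topspace X. \<forall>W. openin X W \<and> x \<in> W \<longrightarrow>
        (\<exists>V. openin X V \<and> x \<in> V \<and> V \<subseteq> W \<and> finite (X frontier_of V)))"

definition acts_by_homeomorphisms ::
  "('g, 'm) monoid_scheme \<Rightarrow> 'a topology \<Rightarrow> ('g \<Rightarrow> 'a \<Rightarrow> 'a) \<Rightarrow> bool" where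
  "acts_by_homeomorphisms G X \<phi> \<longleftrightarrow>
     group_action G (topspace X) \<phi> \<and> (\<forall>g\<in>carrier G. homeomorphic_map X X (\<phi> g))"

definition finite_open_cover :: "'a topology \<Rightarrow> 'a set set \<Rightarrow> bool" where
  "finite_open_cover X \<A> \<longleftrightarrow> finite \<A> \<and> (\<forall>A\<in>\<A>. openin X A) \<and> \<Union>\<A> = topspace X"

text \<open>The intersection with the space only matters for \<open>I = {}\<close>.\<close>

definition common_refinement :: "'a topology \<Rightarrow> 'i set \<Rightarrow> ('i \<Rightarrow> 'a set set) \<Rightarrow> 'a set set" where
  "common_refinement X I \<C> = {topspace X \<inter> (\<Inter>i\<in>I. F i) |F. \<forall>i\<in>I. F i \<in> \<C> i}"

definition min_subcover_card :: "'a topology \<Rightarrow> 'a set set \<Rightarrow> nat" where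
  "min_subcover_card X \<U> =
     (LEAST k. \<exists>\<B>\<subseteq>\<U>. finite \<B> \<and> card \<B> = k \<and> \<Union>\<B> = topspace X)"

definition translate_cover :: "('g \<Rightarrow> 'a \<Rightarrow> 'a) \<Rightarrow> 'g \<Rightarrow> 'a set set \<Rightarrow> 'a set set" where
  "translate_cover \<phi> g \<A> = (\<lambda>A. \<phi> g ` A) ` \<A>"

definition entropy_seq ::
  "'a topology \<Rightarrow> ('g \<Rightarrow> 'a \<Rightarrow> 'a) \<Rightarrow> 'a set set \<Rightarrow> (nat \<Rightarrow> 'g) \<Rightarrow> nat \<Rightarrow> real" where
  "entropy_seq X \<phi> \<A> s n =
     (1 / real n) *
     ln (real (min_subcover_card X
           (common_refinement X {1..n} (\<lambda>i. translate_cover \<phi> (s i) \<A>))))"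

definition h_top ::
  "'a topology \<Rightarrow> ('g \<Rightarrow> 'a \<Rightarrow> 'a) \<Rightarrow> 'a set set \<Rightarrow> (nat \<Rightarrow> 'g) \<Rightarrow> real" where
  "h_top X \<phi> \<A> s = lim (entropy_seq X \<phi> \<A> s)"

text \<open>Convergence is required separately, since \<^const>\<open>lim\<close> is unspecified for
  divergent sequences. Only the values of \<open>s\<close> at positive indices matter.\<close>

definition null_system ::
  "('g, 'm) monoid_scheme \<Rightarrow> 'a topology \<Rightarrow> ('g \<Rightarrow> 'a \<Rightarrow> 'a) \<Rightarrow> bool" where
  "null_system G X \<phi> \<longleftrightarrow>
     (\<forall>\<A> s. finite_open_cover X \<A> \<and> range s \<subseteq> carrier G \<longrightarrow>
        convergent (entropy_seq X \<phi> \<A> s) \<and> h_top X \<phi> \<A> s = 0)"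

definition independent_seq :: "'a set \<Rightarrow> (nat \<Rightarrow> 'a \<Rightarrow> real) \<Rightarrow> bool" where
  "independent_seq S f \<longleftrightarrow>
     (\<exists>a b. a < b \<and>
        (\<forall>P M. finite P \<and> finite M \<and> P \<inter> M = {} \<longrightarrow>
           S \<inter> (\<Inter>n\<in>P. f n -` {..<a}) \<inter> (\<Inter>n\<in>M. f n -` {b<..}) \<noteq> {}))"

definition tame_system ::
  "('g, 'm) monoid_scheme \<Rightarrow> 'a topology \<Rightarrow> ('g \<Rightarrow> 'a \<Rightarrow> 'a) \<Rightarrow> bool" where
  "tame_system G X \<phi> \<longleftrightarrow>
     (\<forall>f. continuous_map X euclideanreal f \<longrightarrow>
        \<not> (\<exists>F. range F \<subseteq> {f \<circ> \<phi> g |g. g \<in> carrier G} \<and> independent_seq (topspace X) F))"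

end

theory Submission
  imports Defs "HOL-Real_Asymp.Real_Asymp"
begin

text \<open>
  Refine the given cover by finitely many open sets with finite boundary, and let \<open>F\<close> be the
  union of these boundaries together with one point of the space. Put \<open>E = s\<^sub>1F \<union> \<dots> \<union> s\<^sub>nF\<close>, a set
  with at most \<open>n |F|\<close> elements. For each \<open>p \<in> E\<close> choose a member \<open>W\<^sub>p\<close> of the joint refinement of
  the translated covers that contains \<open>p\<close>. The union of the \<open>W\<^sub>p\<close> is open, and its boundary lies in
  \<open>E\<close>, hence in the union itself; so the union is clopen and, by connectedness, the whole space.
  Thus \<open>N \<le> n |F|\<close>, and the entropy vanishes. An independent sequence \<open>f g\<^sub>n\<close> with bounds \<open>a < b\<close>
  would instead force \<open>N \<ge> 2\<^sup>n\<close> for the cover \<open>{f < b}, {f > a}\<close> and the sequence of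
  inverses of the \<open>g\<^sub>n\<close>.
\<close>

section \<open>Frontiers in connected spaces\<close>

text \<open>An open set that contains its own frontier is closed. The frontier of the finite union
  lies in \<open>E\<close>, and the union covers \<open>E\<close>, so the union is clopen;
  \<open>E\<close> being nonempty rules out the empty set.\<close>

lemma Union_eq_topspace_if_frontier_subset:
  assumes conn: "connected_space X" and E: "finite E" "E \<noteq> {}" "E \<subseteq> topspace X"
    and W: "\<And>p. p \<in> E \<Longrightarrow> openin X (W p)" "\<And>p. p \<in> E \<Longrightarrow> p \<in> W p"
      "\<And>p. p \<in> E \<Longrightarrow> X frontier_of W p \<subseteq> E"
  shows "(\<Union>p\<in>E. W p) = topspace X"
proof -
  let ?U = "\<Union>p\<in>E. W p"
  have op: "openin X ?U" using W(1) by blast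
  have "X frontier_of ?U \<subseteq> (\<Union>t\<in>W ` E. X frontier_of t)"
    using E(1) by (intro frontier_of_Union_subset) auto
  also have "\<dots> \<subseteq> E" using W(3) by blast
  also have "\<dots> \<subseteq> ?U" using W(2) by blast
  finally have "X frontier_of ?U \<subseteq> ?U" .
  then have "closedin X ?U"
    using frontier_of_subset_eq[OF openin_subset[OF op]] by blast
  moreover have "?U \<noteq> {}" using E(2) W(2) by blast
  ultimately show ?thesis
    using conn op unfolding connected_space_clopen_in by blast
qed

text \<open>The intersection is open, so a frontier point lies outside it and misses some
  \<open>V i\<close>. It still lies in the closure of the smaller set, hence in that of
  \<open>V i\<close>.\<close>

lemma frontier_of_finite_Inter_subset:
  assumes "finite I" "\<And>i. i \<in> I \<Longrightarrow> openin X (V i)"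
  shows "X frontier_of (topspace X \<inter> (\<Inter>i\<in>I. V i)) \<subseteq> (\<Union>i\<in>I. X frontier_of V i)"
proof
  let ?W = "topspace X \<inter> (\<Inter>i\<in>I. V i)"
  have op: "openin X ?W"
    using assms by (cases "I = {}") (auto intro!: openin_Int openin_INT)
  fix x assume "x \<in> X frontier_of ?W"
  then have x: "x \<in> X closure_of ?W" "x \<notin> ?W"
    using op by (auto simp: frontier_of_def interior_of_openin)
  then have "x \<in> topspace X" using closure_of_subset_topspace by fastforce
  with x(2) obtain i where i: "i \<in> I" "x \<notin> V i" by blast
  have "X closure_of ?W \<subseteq> X closure_of V i"
    using i(1) by (intro closure_of_mono) auto
  then have "x \<in> X frontier_of V i"
    using x(1) i assms(2)[OF i(1)] by (auto simp: frontier_of_def interior_of_openin)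
  with i(1) show "x \<in> (\<Union>i\<in>I. X frontier_of V i)" by blast
qed

section \<open>Minimal subcovers and joint refinements\<close>

lemma min_subcover_card_le:
  assumes "finite \<B>" "\<B> \<subseteq> \<U>" "\<Union>\<B> = topspace X"
  shows "min_subcover_card X \<U> \<le> card \<B>"
  unfolding min_subcover_card_def using assms by (intro Least_le) blast

text \<open>\<open>LEAST\<close> is meaningful only for a satisfiable predicate, so one finite
  subcover has to be supplied before the minimum is known to be attained.\<close>

lemma min_subcover_attained:
  assumes "finite \<B>" "\<B> \<subseteq> \<U>" "\<Union>\<B> = topspace X"
  obtains \<D> where "\<D> \<subseteq> \<U>" "finite \<D>" "card \<D> = min_subcover_card X \<U>" "\<Union>\<D> = topspace X"
proof -
  have "\<exists>k. \<exists>\<B>\<subseteq>\<U>. finite \<B> \<and> card \<B> = k \<and> \<Union>\<B> = topspace X" using assms by blast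
  from LeastI_ex[OF this] that show ?thesis
    unfolding min_subcover_card_def by blast
qed

lemma common_refinement_subcover_bound:
  assumes conn: "connected_space X" and E: "finite E" "E \<noteq> {}" "E \<subseteq> topspace X"
    and "finite I"
    and V: "\<And>i x. i \<in> I \<Longrightarrow> x \<in> topspace X \<Longrightarrow>
      \<exists>V. openin X V \<and> x \<in> V \<and> X frontier_of V \<subseteq> E \<and> (\<exists>A\<in>\<C> i. V \<subseteq> A)"
  obtains \<B> where "finite \<B>" "\<B> \<subseteq> common_refinement X I \<C>" "\<Union>\<B> = topspace X" "card \<B> \<le> card E"
proof -
  have "\<forall>p\<in>E. \<forall>i\<in>I. \<exists>V A. openin X V \<and> p \<in> V \<and> X frontier_of V \<subseteq> E \<and> A \<in> \<C> i \<and> V \<subseteq> A"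
    using V E(3) by (meson subsetD)
  then obtain V A where VA: "\<And>p i. p \<in> E \<Longrightarrow> i \<in> I \<Longrightarrow>
      openin X (V p i) \<and> p \<in> V p i \<and> X frontier_of (V p i) \<subseteq> E \<and> A p i \<in> \<C> i \<and> V p i \<subseteq> A p i"
    by metis
  \<comment> \<open>Two families run in parallel: \<open>W p\<close> has its frontier inside
    \<open>E\<close> but need not belong to the refinement, while \<open>B p\<close> belongs to it
    but may have any frontier. Covering is proved for \<open>W\<close> and passes to the larger sets
    \<open>B p\<close>.\<close>
  define W where "W p = topspace X \<inter> (\<Inter>i\<in>I. V p i)" for p
  define B where "B p = topspace X \<inter> (\<Inter>i\<in>I. A p i)" for p
  have W: "(\<Union>p\<in>E. W p) = topspace X"
  proof (rule Union_eq_topspace_if_frontier_subset[OF conn E])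
    fix p assume p: "p \<in> E"
    show "openin X (W p)" using VA[OF p] \<open>finite I\<close> unfolding W_def
      by (cases "I = {}") (auto intro!: openin_Int openin_INT)
    show "p \<in> W p" using VA[OF p] p E(3) unfolding W_def by blast
    have "X frontier_of W p \<subseteq> (\<Union>i\<in>I. X frontier_of V p i)"
      unfolding W_def using VA[OF p] by (intro frontier_of_finite_Inter_subset \<open>finite I\<close>) blast
    then show "X frontier_of W p \<subseteq> E" using VA[OF p] by blast
  qed
  have "\<Union>(B ` E) = topspace X"
  proof
    show "\<Union>(B ` E) \<subseteq> topspace X" unfolding B_def by blast
    have "W p \<subseteq> B p" if "p \<in> E" for p using VA[OF that] unfolding W_def B_def by blast
    then have "(\<Union>p\<in>E. W p) \<subseteq> \<Union>(B ` E)" by (intro UN_mono) simp_all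
    then show "topspace X \<subseteq> \<Union>(B ` E)" unfolding W .
  qed
  moreover have "B ` E \<subseteq> common_refinement X I \<C>"
    using VA unfolding B_def common_refinement_def by blast
  ultimately show ?thesis using that[of "B ` E"] E(1) card_image_le by blast
qed

section \<open>Linear growth of subcovers and zero entropy\<close>

lemma rim_finite_refinement:
  assumes "compact_space X" "rim_finite_space X" "finite_open_cover X \<A>"
  obtains \<V> where "finite \<V>" "\<Union>\<V> = topspace X"
    "\<And>V. V \<in> \<V> \<Longrightarrow> openin X V \<and> finite (X frontier_of V) \<and> (\<exists>A\<in>\<A>. V \<subseteq> A)"
proof -
  define \<U> where "\<U> = {V. openin X V \<and> finite (X frontier_of V) \<and> (\<exists>A\<in>\<A>. V \<subseteq> A)}"
  have \<U>: "openin X V \<and> finite (X frontier_of V) \<and> (\<exists>A\<in>\<A>. V \<subseteq> A)" if "V \<in> \<U>" for V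
    using that unfolding \<U>_def by simp
  have "\<Union>\<U> = topspace X"
  proof
    show "\<Union>\<U> \<subseteq> topspace X" using \<U> openin_subset by (metis Union_least)
    show "topspace X \<subseteq> \<Union>\<U>"
    proof
      fix x assume x: "x \<in> topspace X"
      have "x \<in> \<Union>\<A>" "\<forall>A\<in>\<A>. openin X A"
        using assms(3) x unfolding finite_open_cover_def by simp_all
      then obtain A where A: "A \<in> \<A>" "openin X A" "x \<in> A" by blast
      have "\<exists>V. openin X V \<and> x \<in> V \<and> V \<subseteq> A \<and> finite (X frontier_of V)"
        using assms(2) x A(2,3) unfolding rim_finite_space_def by simp
      then obtain V where V: "openin X V" "x \<in> V" "V \<subseteq> A" "finite (X frontier_of V)"
        by (elim exE conjE)
      then have "V \<in> \<U>" using A(1) unfolding \<U>_def by blast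
      with V(2) show "x \<in> \<Union>\<U>" by (rule UnionI[rotated])
    qed
  qed
  moreover have "Ball \<U> (openin X)" using \<U> by blast
  ultimately obtain \<V> where "finite \<V>" "\<V> \<subseteq> \<U>" "\<Union>\<V> = topspace X"
    using assms(1) unfolding compact_space by metis
  then show ?thesis using that[of \<V>] \<U> by (meson subsetD)
qed

text \<open>The constant \<open>m\<close> is chosen before \<open>s\<close> and \<open>n\<close>: it
  counts the points of \<open>F\<close>, which depends only on the refinement of
  \<open>\<A>\<close>, and each translate of \<open>F\<close> has at most as many points.\<close>

lemma translate_subcover_bound:
  assumes comp: "compact_space X" and conn: "connected_space X" and rim: "rim_finite_space X"
    and act: "acts_by_homeomorphisms G X \<phi>"
    and ne: "topspace X \<noteq> {}" and cov: "finite_open_cover X \<A>"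
  obtains m where "m \<ge> 1"
    "\<And>s n. range s \<subseteq> carrier G \<Longrightarrow> n \<ge> 1 \<Longrightarrow>
       min_subcover_card X (common_refinement X {1..n} (\<lambda>i. translate_cover \<phi> (s i) \<A>)) \<le> n * m"
proof -
  obtain \<V> where \<V>: "finite \<V>" "\<Union>\<V> = topspace X"
    "\<And>V. V \<in> \<V> \<Longrightarrow> openin X V \<and> finite (X frontier_of V) \<and> (\<exists>A\<in>\<A>. V \<subseteq> A)"
    using rim_finite_refinement[OF comp rim cov] by blast
  obtain x0 where x0: "x0 \<in> topspace X" using ne by blast
  \<comment> \<open>All frontiers may be empty; \<open>x0\<close> keeps \<open>F\<close>, and hence
    \<open>E\<close>, nonempty.\<close>
  define F where "F = insert x0 (\<Union>V\<in>\<V>. X frontier_of V)"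
  have fF: "finite F" using \<V> unfolding F_def by blast
  have FX: "F \<subseteq> topspace X" using x0 frontier_of_subset_topspace unfolding F_def by fast
  have "card F \<ge> 1" using fF by (simp add: F_def card_gt_0_iff Suc_le_eq)
  moreover have "min_subcover_card X (common_refinement X {1..n} (\<lambda>i. translate_cover \<phi> (s i) \<A>))
      \<le> n * card F" if s: "range s \<subseteq> carrier G" and n: "n \<ge> 1" for s and n :: nat
  proof -
    define E where "E = (\<Union>i\<in>{1..n}. \<phi> (s i) ` F)"
    have hom: "homeomorphic_map X X (\<phi> (s i))" for i
      using act s unfolding acts_by_homeomorphisms_def by blast
    have fE: "finite E" using fF unfolding E_def by blast
    have E0: "E \<noteq> {}" using n unfolding E_def F_def by auto
    have EX: "E \<subseteq> topspace X"
      using FX homeomorphic_imp_surjective_map[OF hom] unfolding E_def by blast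
    have "\<exists>V. openin X V \<and> x \<in> V \<and> X frontier_of V \<subseteq> E \<and> (\<exists>A\<in>translate_cover \<phi> (s i) \<A>. V \<subseteq> A)"
      if i: "i \<in> {1..n}" and x: "x \<in> topspace X" for i x
    proof -
      \<comment> \<open>Choose the neighbourhood at the preimage \<open>y\<close> and push it
        forward: the homeomorphism carries frontiers to frontiers, so the new frontier lies in the
        translate of \<open>F\<close> by \<open>s i\<close>.\<close>
      obtain y where y: "y \<in> topspace X" "x = \<phi> (s i) y"
        using homeomorphic_imp_surjective_map[OF hom] x by blast
      then obtain V A where V: "V \<in> \<V>" "y \<in> V" "openin X V" "A \<in> \<A>" "V \<subseteq> A"
        using \<V> by blast
      have "X frontier_of (\<phi> (s i) ` V) = \<phi> (s i) ` (X frontier_of V)"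
        using homeomorphic_map_frontier_of[OF hom] V(3) openin_subset by blast
      also have "\<dots> \<subseteq> E" using V(1) i unfolding E_def F_def by blast
      finally have front: "X frontier_of (\<phi> (s i) ` V) \<subseteq> E" .
      have "openin X (\<phi> (s i) ` V)"
        using homeomorphic_map_openness_eq[OF hom] V(3) by blast
      moreover have "\<phi> (s i) ` A \<in> translate_cover \<phi> (s i) \<A>" "\<phi> (s i) ` V \<subseteq> \<phi> (s i) ` A"
        using V(4,5) unfolding translate_cover_def by blast+
      moreover have "x \<in> \<phi> (s i) ` V" using V(2) y(2) by blast
      ultimately show ?thesis using front by (intro exI[of _ "\<phi> (s i) ` V"] conjI bexI)
    qed
    then obtain \<B> where \<B>: "finite \<B>" "\<Union>\<B> = topspace X" "card \<B> \<le> card E"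
      "\<B> \<subseteq> common_refinement X {1..n} (\<lambda>i. translate_cover \<phi> (s i) \<A>)"
      by (rule common_refinement_subcover_bound[OF conn fE E0 EX finite_atLeastAtMost[of 1 n],
            of "\<lambda>i. translate_cover \<phi> (s i) \<A>"])
    have "card E \<le> (\<Sum>i\<in>{1..n}. card (\<phi> (s i) ` F))"
      unfolding E_def by (rule card_UN_le) simp
    also have "\<dots> \<le> (\<Sum>i\<in>{1..n}. card F)"
      by (intro sum_mono card_image_le fF)
    finally show ?thesis using min_subcover_card_le[OF \<B>(1,4,2)] \<B>(3) by simp
  qed
  ultimately show ?thesis using that by blast
qed

lemma entropy_seq_tendsto_0:
  assumes "compact_space X" "connected_space X" "rim_finite_space X"
    and "acts_by_homeomorphisms G X \<phi>"
    and cov: "finite_open_cover X \<A>" and s: "range s \<subseteq> carrier G"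
  shows "entropy_seq X \<phi> \<A> s \<longlonglongrightarrow> 0"
proof -
  define N where
    "N n = min_subcover_card X (common_refinement X {1..n} (\<lambda>i. translate_cover \<phi> (s i) \<A>))" for n
  have "\<exists>m\<ge>1. \<forall>n\<ge>1. N n \<le> n * m"
  proof (cases "topspace X = {}")
    \<comment> \<open>The empty space counts as connected but offers no point \<open>x0\<close>;
      here the empty family is already a subcover.\<close>
    case True
    then have "N n = 0" for n using min_subcover_card_le[of "{}" _ X] unfolding N_def by simp
    then show ?thesis by auto
  next
    case False
    then show ?thesis unfolding N_def using translate_subcover_bound[OF assms(1-4) _ cov] s by metis
  qed
  then obtain m where m: "m \<ge> 1" "\<And>n. n \<ge> 1 \<Longrightarrow> N n \<le> n * m" by blast
  \<comment> \<open>The value \<open>N n = 0\<close> is harmless because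
    \<open>ln 0 = 0\<close>.\<close>
  have lnN: "0 \<le> ln (real (N n))" for n by (cases "N n = 0") auto
  have up: "ln (real (N n)) \<le> ln (real n * real m)" if "n \<ge> 1" for n
  proof (cases "N n = 0")
    case True
    then show ?thesis using m(1) that by (simp add: mult_ge1_I)
  next
    case False
    have "real (N n) \<le> real n * real m" using m(2)[OF that] by (simp flip: of_nat_mult)
    with False show ?thesis by (intro ln_mono) auto
  qed
  have "real m > 0" using m(1) by simp
  then have lim: "(\<lambda>n. 1 / real n * ln (real n * real m)) \<longlonglongrightarrow> 0" by real_asymp
  have eq: "entropy_seq X \<phi> \<A> s n = 1 / real n * ln (real (N n))" for n
    unfolding entropy_seq_def N_def ..
  show ?thesis
  proof (rule tendsto_sandwich[OF _ _ tendsto_const lim])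
    show "\<forall>\<^sub>F n in sequentially. 0 \<le> entropy_seq X \<phi> \<A> s n"
      unfolding eq using lnN by simp
    show "\<forall>\<^sub>F n in sequentially. entropy_seq X \<phi> \<A> s n \<le> 1 / real n * ln (real n * real m)"
      using eventually_ge_at_top[of 1]
      by eventually_elim (unfold eq, intro mult_left_mono up, auto)
  qed
qed

section \<open>Independence and exponential growth\<close>

text \<open>The point that \<open>sep\<close> gives for \<open>P\<close> avoids \<open>V i\<close>
  on \<open>P\<close> and \<open>U i\<close> off \<open>P\<close>, so among the sets
  \<open>B Q\<close> with \<open>Q \<subseteq> I\<close> only \<open>B P\<close> contains it. Every
  subcover must therefore contain each \<open>B P\<close>.\<close>

lemma two_power_le_min_subcover_card:
  assumes fin: "finite I" and cov: "\<And>i. i \<in> I \<Longrightarrow> topspace X \<subseteq> U i \<union> V i"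
    and sep: "\<And>P. P \<subseteq> I \<Longrightarrow>
      topspace X \<inter> (\<Inter>i\<in>P. - V i) \<inter> (\<Inter>i\<in>I - P. - U i) \<noteq> {}"
  shows "2 ^ card I \<le> min_subcover_card X (common_refinement X I (\<lambda>i. {U i, V i}))"
proof -
  let ?R = "common_refinement X I (\<lambda>i. {U i, V i})"
  define B where "B P = topspace X \<inter> (\<Inter>i\<in>I. if i \<in> P then U i else V i)" for P
  have R: "?R = B ` Pow I"
  proof
    show "B ` Pow I \<subseteq> ?R"
    proof
      fix C assume "C \<in> B ` Pow I"
      then obtain P where "C = B P" by blast
      then show "C \<in> ?R" unfolding common_refinement_def B_def
        by (intro CollectI exI[of _ "\<lambda>i. if i \<in> P then U i else V i"]) simp
    qed
    show "?R \<subseteq> B ` Pow I"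
    proof
      fix C assume "C \<in> ?R"
      then obtain F where F: "\<forall>i\<in>I. F i \<in> {U i, V i}" "C = topspace X \<inter> (\<Inter>i\<in>I. F i)"
        unfolding common_refinement_def by blast
      have "F i = (if i \<in> {i\<in>I. F i = U i} then U i else V i)" if "i \<in> I" for i
        using F(1) that by auto
      then have "C = B {i\<in>I. F i = U i}"
        unfolding F(2) B_def by (intro arg_cong2[where f = "(\<inter>)"] INF_cong refl)
      then show "C \<in> B ` Pow I" by blast
    qed
  qed
  have "\<Union>(B ` Pow I) = topspace X"
  proof
    show "\<Union>(B ` Pow I) \<subseteq> topspace X" unfolding B_def by blast
    show "topspace X \<subseteq> \<Union>(B ` Pow I)"
    proof
      fix x assume "x \<in> topspace X"
      then have "x \<in> B {i\<in>I. x \<in> U i}" unfolding B_def using cov by auto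
      then show "x \<in> \<Union>(B ` Pow I)" by (intro UN_I[of "{i\<in>I. x \<in> U i}"]) auto
    qed
  qed
  then obtain \<D> where \<D>: "\<D> \<subseteq> ?R" "finite \<D>" "card \<D> = min_subcover_card X ?R"
    "\<Union>\<D> = topspace X"
    using min_subcover_attained[of "B ` Pow I" ?R X] fin R by auto
  \<comment> \<open>Decode each \<open>D\<close> in the subcover to an index set. The member
    containing the point for \<open>P\<close> has \<open>P\<close> as its only index set, so
    decoding is onto \<open>Pow I\<close>.\<close>
  have "Pow I \<subseteq> (\<lambda>D. SOME P. P \<subseteq> I \<and> D = B P) ` \<D>"
  proof
    fix P assume "P \<in> Pow I"
    then have P: "P \<subseteq> I" by blast
    obtain x where "x \<in> topspace X \<inter> (\<Inter>i\<in>P. - V i) \<inter> (\<Inter>i\<in>I - P. - U i)"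
      using sep[OF P] by (meson ex_in_conv)
    then have x: "x \<in> topspace X" "\<And>i. i \<in> P \<Longrightarrow> x \<notin> V i" "\<And>i. i \<in> I - P \<Longrightarrow> x \<notin> U i"
      by (blast dest: INT_D)+
    have uniq: "Q = P" if "Q \<subseteq> I" "x \<in> B Q" for Q
    proof -
      have "i \<in> Q \<longleftrightarrow> i \<in> P" if i: "i \<in> I" for i
      proof -
        have "x \<in> (if i \<in> Q then U i else V i)" using \<open>x \<in> B Q\<close> i unfolding B_def by blast
        then show ?thesis using i x(2,3)[of i] by (cases "i \<in> Q") auto
      qed
      then show ?thesis using P \<open>Q \<subseteq> I\<close> by blast
    qed
    obtain D where D: "D \<in> \<D>" "x \<in> D" using \<D>(4) x(1) by blast
    then have "\<exists>Q. Q \<subseteq> I \<and> D = B Q" using \<D>(1) R by blast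
    from someI_ex[OF this] have "(SOME Q. Q \<subseteq> I \<and> D = B Q) = P" using uniq D(2) by blast
    then show "P \<in> (\<lambda>D. SOME P. P \<subseteq> I \<and> D = B P) ` \<D>" using D(1) by blast
  qed
  then have "card (Pow I) \<le> card \<D>" using surj_card_le \<D>(2) by blast
  then show ?thesis using \<D>(3) fin by (simp add: card_Pow)
qed

text \<open>Entropy translates covers by images, whereas independence of
  \<open>f \<circ> \<phi> g\<close> concerns preimages; passing to inverses matches the two.\<close>

lemma (in group_action) image_inv_eq:
  assumes "g \<in> carrier G" "A \<subseteq> E"
  shows "\<phi> (inv\<^bsub>G\<^esub> g) ` A = {x \<in> E. \<phi> g x \<in> A}"
proof -
  interpret group G using group_hom group_hom.axioms(1) by blast
  show ?thesis
  proof (intro equalityI subsetI)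
    fix x assume "x \<in> \<phi> (inv\<^bsub>G\<^esub> g) ` A"
    then obtain y where y: "y \<in> A" "x = \<phi> (inv\<^bsub>G\<^esub> g) y" by blast
    then have "\<phi> g x = y" "x \<in> E"
      using assms orbit_sym_aux[of "inv\<^bsub>G\<^esub> g" y x] element_image[of "inv\<^bsub>G\<^esub> g" y x] by auto
    then show "x \<in> {x \<in> E. \<phi> g x \<in> A}" using y by simp
  next
    fix x assume "x \<in> {x \<in> E. \<phi> g x \<in> A}"
    then show "x \<in> \<phi> (inv\<^bsub>G\<^esub> g) ` A"
      using assms orbit_sym_aux[of g x "\<phi> g x"] by force
  qed
qed

lemma null_imp_tame:
  assumes act: "group_action G (topspace X) \<phi>" and null: "null_system G X \<phi>"
  shows "tame_system G X \<phi>"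
  unfolding tame_system_def
proof (intro allI impI notI)
  interpret group_action G "topspace X" \<phi> by (rule act)
  fix f assume f: "continuous_map X euclideanreal f"
  assume "\<exists>F. range F \<subseteq> {f \<circ> \<phi> g |g. g \<in> carrier G} \<and> independent_seq (topspace X) F"
  then obtain F where F: "\<And>n. \<exists>g\<in>carrier G. F n = f \<circ> \<phi> g" "independent_seq (topspace X) F"
    by blast
  from F(1) obtain g where g: "\<And>n. g n \<in> carrier G" "\<And>n. F n = f \<circ> \<phi> (g n)" by metis
  from F(2)[unfolded independent_seq_def] obtain a b where ab: "a < b"
    and ind: "\<And>P M. finite P \<Longrightarrow> finite M \<Longrightarrow> P \<inter> M = {} \<Longrightarrow>
      topspace X \<inter> (\<Inter>n\<in>P. F n -` {..<a}) \<inter> (\<Inter>n\<in>M. F n -` {b<..}) \<noteq> {}"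
    by (elim exE conjE) metis
  \<comment> \<open>The two sets overlap where \<open>a < f x < b\<close>, so they cover the space.
    Yet \<open>f x < a\<close> excludes \<open>B\<close> and \<open>f x > b\<close> excludes
    \<open>A\<close>, which is what separation by independence needs.\<close>
  define A where "A = {x \<in> topspace X. f x < b}"
  define B where "B = {x \<in> topspace X. f x > a}"
  define s where "s n = inv\<^bsub>G\<^esub> (g n)" for n
  have "openin X A" "openin X B"
    using openin_continuous_map_preimage[OF f, of "{..<b}"]
      openin_continuous_map_preimage[OF f, of "{a<..}"] unfolding A_def B_def by auto
  then have cov: "finite_open_cover X {A, B}"
    unfolding finite_open_cover_def A_def B_def using ab by auto
  have s: "range s \<subseteq> carrier G"
    using g(1) group.inv_closed[OF group_hom.axioms(1)[OF group_hom]] unfolding s_def by blast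
  have img: "\<phi> (s n) ` A = {x \<in> topspace X. F n x < b}" "\<phi> (s n) ` B = {x \<in> topspace X. F n x > a}"
    for n
    using image_inv_eq[OF g(1), of A n] image_inv_eq[OF g(1), of B n] element_image[OF g(1)]
    unfolding A_def B_def s_def g(2) by auto
  \<comment> \<open>At least \<open>2 ^ n\<close> members are needed at stage \<open>n\<close>, so
    every term from index 1 on is at least \<open>ln 2\<close>, and the limit cannot be 0.\<close>
  have "ln 2 \<le> entropy_seq X \<phi> {A, B} s n" if n: "n \<ge> 1" for n
  proof -
    let ?N = "min_subcover_card X (common_refinement X {1..n} (\<lambda>i. translate_cover \<phi> (s i) {A, B}))"
    have "2 ^ card {1..n} \<le> min_subcover_card X
        (common_refinement X {1..n} (\<lambda>i. {\<phi> (s i) ` A, \<phi> (s i) ` B}))"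
    proof (rule two_power_le_min_subcover_card)
      show "topspace X \<subseteq> \<phi> (s i) ` A \<union> \<phi> (s i) ` B" for i
        unfolding img using ab by auto
      fix P assume "P \<subseteq> {1..n}"
      then have "topspace X \<inter> (\<Inter>n\<in>P. F n -` {..<a}) \<inter> (\<Inter>n\<in>{1..n} - P. F n -` {b<..}) \<noteq> {}"
        by (intro ind) (auto intro: finite_subset)
      \<comment> \<open>Here the translates of \<open>A\<close> and \<open>B\<close> play the roles
        of \<open>U i\<close> and \<open>V i\<close>.\<close>
      moreover have "(\<Inter>n\<in>P. F n -` {..<a}) \<subseteq> (\<Inter>i\<in>P. - \<phi> (s i) ` B)"
        unfolding img by (intro INF_mono') auto
      moreover have "(\<Inter>n\<in>{1..n} - P. F n -` {b<..}) \<subseteq> (\<Inter>i\<in>{1..n} - P. - \<phi> (s i) ` A)"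
        unfolding img by (intro INF_mono') auto
      ultimately show "topspace X \<inter> (\<Inter>i\<in>P. - \<phi> (s i) ` B) \<inter> (\<Inter>i\<in>{1..n} - P. - \<phi> (s i) ` A) \<noteq> {}"
        by (metis (no_types, lifting) Int_mono order_refl subset_empty)
    qed simp
    then have "2 ^ n \<le> ?N" unfolding translate_cover_def by simp
    then have "2 ^ n \<le> real ?N" by (metis of_nat_le_iff of_nat_numeral of_nat_power)
    then have "ln (2 ^ n) \<le> ln (real ?N)" by (intro ln_mono) auto
    then show ?thesis using n unfolding entropy_seq_def by (simp add: ln_realpow field_simps)
  qed
  moreover have "convergent (entropy_seq X \<phi> {A, B} s)" "lim (entropy_seq X \<phi> {A, B} s) = 0"
    using null[unfolded null_system_def h_top_def, rule_format, of "{A, B}" s] cov s by simp_all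
  then have "entropy_seq X \<phi> {A, B} s \<longlonglongrightarrow> 0" by (simp add: convergent_LIMSEQ_iff)
  ultimately have "ln 2 \<le> (0 :: real)" by (meson LIMSEQ_le_const)
  then show False by simp
qed

theorem theorem1p2:
  fixes X :: "'a topology"
    and G :: "('g, 'm) monoid_scheme"
    and \<phi> :: "'g \<Rightarrow> 'a \<Rightarrow> 'a"
  assumes "continuum_space X"
    and "rim_finite_space X"
    and "group G"
    and "acts_by_homeomorphisms G X \<phi>"
  shows "null_system G X \<phi> \<and> tame_system G X \<phi>"
proof -
  have "null_system G X \<phi>"
    unfolding null_system_def h_top_def
    using entropy_seq_tendsto_0[of X G \<phi>] assms(1,2,4)
    unfolding continuum_space_def by (metis convergentI limI)
  then show ?thesis
    using null_imp_tame assms(4) unfolding acts_by_homeomorphisms_def by blast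
qed

end
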